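(* Let $n\geq3$. (1) If $u=\mathcal{P}_{\mathbb{B}^{n}}[\phi]$ with $\phi\in L^{1}(\mathbb{S}^{n-1},\mathbb{R})$, then for any $x\in\mathbb{B}^{n}$ the following sharp inequality holds: $$|\nabla u(x)|\leq 2(n-1)\frac{(1+|x|)^{n-2}}{(1-|x|)^{n}}\|\phi\|_{L^{1}(\mathbb{S}^{n-1},\mathbb{R})}.$$ (2) If $u=\mathcal{P}_{\mathbb{H}^{n}}[\phi]$ with $\phi\in L^{1}(\mathbb{R}^{n-1},\mathbb{R})$, then for any $x\in\mathbb{H}^{n}$ the following sharp inequality holds: $$|\nabla u(x)|\leq\frac{2^{n-2}(n-1)\Gamma(\frac{n}{2})}{\pi^{\frac{n}{2}}x_{n}^{n}}\|\phi\|_{L^{1}(\mathbb{R}^{n-1},\mathbb{R})}.$$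
   Context: $|\cdot|$ is the Euclidean norm on $\mathbb{R}^n$; $\mathbb{B}^n=\{|x|<1\}$, $\mathbb{S}^{n-1}=\{|x|=1\}$, $\mathbb{H}^n=\{x=(x',x_n): x'\in\mathbb{R}^{n-1},\,x_n>0\}$. $\Gamma$ is the Gamma function. $\sigma$ is the surface measure on $\mathbb{S}^{n-1}$ normalized so that $\sigma(\mathbb{S}^{n-1})=1$, and $V_{n-1}$ is Lebesgue measure on $\mathbb{R}^{n-1}$; $L^1(\mathbb{S}^{n-1},\mathbb{R})$ and $L^1(\mathbb{R}^{n-1},\mathbb{R})$ are taken with respect to these. Poisson–Szegő integrals (for the hyperbolic Laplacian): $$\mathcal{P}_{\mathbb{B}^n}[\phi](x)=\int_{\mathbb{S}^{n-1}}\Big(\frac{1-|x|^2}{|x-\zeta|^2}\Big)^{n-1}\phi(\zeta)\,d\sigma(\zeta),\quad x\in\mathbb{B}^n,$$ $$\mathcal{P}_{\mathbb{H}^n}[\phi](x)=c_n\int_{\mathbb{R}^{n-1}}\Big(\frac{x_n}{|x'-y'|^2+x_n^2}\Big)^{n-1}\phi(y')\,dV_{n-1}(y'),\quad x\in\mathbb{H}^n,\qquad c_n=\frac{2^{n-2}\Gamma(n/2)}{\pi^{n/2}}.$$ "Sharp" means that, for each fixed $x$, the coefficient multiplying $\|\phi\|_{L^1}$ is the smallest constant for which the inequality holds for all $\phi\in L^1$. *)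

theory Defs
  imports "HOL-Analysis.Analysis"
begin

(* Junk value where f is not differentiable; see gradient_eqI and GDERIV_gradient. *)
definition gradient :: "('a::euclidean_space \<Rightarrow> real) \<Rightarrow> 'a \<Rightarrow> 'a" where
  "gradient f x = (THE D. GDERIV f x :> D)"

lemma gradient_eqI:
  assumes "GDERIV f x :> D"
  shows "gradient f x = D"
  unfolding gradient_def
proof (rule the_equality[where P = "\<lambda>D. GDERIV f x :> D"])
  show "GDERIV f x :> D" by fact
next
  fix D' assume "GDERIV f x :> D'"
  then have "(\<lambda>h. inner h D') = (\<lambda>h. inner h D)"
    using assms has_derivative_unique unfolding gderiv_def by blast
  then have "\<forall>h. inner h D' = inner h D" by (rule fun_cong[THEN allI])
  then show "D' = D" by (rule vector_eq_ldot[THEN iffD1])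
qed

lemma GDERIV_gradient:
  fixes f :: "'a::euclidean_space \<Rightarrow> real"
  assumes "f differentiable (at x)"
  shows "GDERIV f x :> gradient f x"
proof -
  obtain f' where f': "(f has_derivative f') (at x)"
    using assms by (auto simp: differentiable_def)
  interpret linear f' using f' has_derivative_linear by blast
  have "f' = (\<lambda>h. inner h (adjoint f' 1))"
    using adjoint_works[OF linear_axioms, of _ 1] by (simp add: fun_eq_iff)
  then have "GDERIV f x :> adjoint f' 1"
    using f' by (simp add: gderiv_def)
  then show ?thesis using gradient_eqI[of f x] by simp
qed

text \<open>
  The normalized surface measure on the unit sphere: a subset A of the sphere has the
  mass of the cone over A in the unit ball, relative to the volume of the whole ball.  Here
  \<^term>\<open>sgn x\<close> is the radial projection x/|x|.  The completion makes integrability with respect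
  to this measure match integrability with respect to \<^term>\<open>lebesgue\<close>.
\<close>
definition sphere_measure :: "'a::euclidean_space measure" where
  "sphere_measure =
     completion (restrict_space
       (distr (uniform_measure lborel (ball 0 1)) borel sgn) (sphere 0 1))"

lemma space_sphere_measure: "space sphere_measure = sphere 0 1"
  by (simp add: sphere_measure_def space_restrict_space)

lemma sgn_measurable: "sgn \<in> borel_measurable (borel :: 'a::euclidean_space measure)"
  unfolding sgn_div_norm by measurable

lemma emeasure_sphere_measure:
  fixes A :: "'a::euclidean_space set"
  assumes "A \<in> sets borel" "A \<subseteq> sphere 0 1"
  shows "emeasure sphere_measure A =
    emeasure lborel {x \<in> ball 0 1. sgn x \<in> A} / emeasure lborel (ball (0::'a) 1)"
proof -
  let ?U = "uniform_measure lborel (ball (0::'a) 1)"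
  let ?D = "distr ?U borel sgn"
  have sph: "sphere (0::'a) 1 \<inter> space ?D \<in> sets ?D" by simp
  have A: "A \<in> sets (restrict_space ?D (sphere 0 1))"
    using assms by (auto simp: sets_restrict_space_iff[OF sph])
  have m: "sgn \<in> measurable ?U (borel :: 'a measure)"
    using sgn_measurable by (simp cong: measurable_cong_sets)
  have v: "sgn -` A \<in> sets (borel :: 'a measure)"
    using measurable_sets[OF sgn_measurable assms(1)] by simp
  have "emeasure sphere_measure A = emeasure ?D A"
    unfolding sphere_measure_def
    using A assms by (simp add: emeasure_restrict_space[OF sph])
  also have "\<dots> = emeasure ?U (sgn -` A)"
    using m assms by (simp add: emeasure_distr)
  also have "\<dots> = emeasure lborel (ball 0 1 \<inter> sgn -` A) / emeasure lborel (ball (0::'a) 1)"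
    using v by (simp add: emeasure_uniform_measure)
  also have "ball 0 1 \<inter> sgn -` A = {x \<in> ball 0 1. sgn x \<in> A}" by auto
  finally show ?thesis .
qed

lemma emeasure_sphere_measure_space:
  "emeasure sphere_measure (sphere (0::'a::euclidean_space) 1) = 1"
proof -
  let ?b = "emeasure lborel (ball (0::'a) 1)"
  have set: "{x \<in> ball 0 1. sgn x \<in> sphere (0::'a) 1} = ball 0 1 - {0}"
    by (auto simp: norm_sgn)
  have diff: "emeasure lborel (ball (0::'a) 1 - {0}) = ?b"
    by (rule emeasure_Diff_null_set) (auto simp: null_sets_def)
  have nz: "?b \<noteq> 0"
    using open_not_negligible[of "ball (0::'a) 1"]
    by (auto simp: negligible_iff_null_sets null_sets_completion_iff null_sets_def)
  have fin: "?b \<noteq> top"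
    using emeasure_lborel_ball_finite[of "0::'a" 1] by auto
  have "emeasure sphere_measure (sphere (0::'a) 1) = ?b / ?b"
    using emeasure_sphere_measure[of "sphere (0::'a) 1"] unfolding set diff by simp
  also have "\<dots> = 1"
    using nz fin by (simp add: ennreal_divide_self less_top)
  finally show ?thesis .
qed

definition L1_norm :: "'a measure \<Rightarrow> ('a \<Rightarrow> real) \<Rightarrow> real" where
  "L1_norm M \<phi> = (LINT y|M. \<bar>\<phi> y\<bar>)"

definition poisson_ball :: "(real^'n \<Rightarrow> real) \<Rightarrow> real^'n \<Rightarrow> real" where
  "poisson_ball \<phi> x =
     (LINT \<zeta>|sphere_measure.
        ((1 - (norm x)\<^sup>2) / (norm (x - \<zeta>))\<^sup>2) ^ (CARD('n) - 1) * \<phi> \<zeta>)"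

definition halfspace_const :: "nat \<Rightarrow> real" where
  "halfspace_const n = 2 ^ (n - 2) * Gamma (real n / 2) / pi powr (real n / 2)"

text \<open>
  A point of n-space is written as a pair (x', x_n) in \<^typ>\<open>(real^'m) \<times> real\<close>, where 'm has
  n - 1 elements; the norm of this product type is the Euclidean one.
\<close>
definition upper_halfspace :: "((real^'m) \<times> real) set" where
  "upper_halfspace = {x. 0 < snd x}"

definition poisson_halfspace :: "(real^'m \<Rightarrow> real) \<Rightarrow> (real^'m) \<times> real \<Rightarrow> real" where
  "poisson_halfspace \<phi> x =
     halfspace_const (CARD('m) + 1) *
     (LINT y|lebesgue.
        (snd x / ((norm (fst x - y))\<^sup>2 + (snd x)\<^sup>2)) ^ CARD('m) * \<phi> y)"

end

theory Submission
  imports Defs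
begin

text \<open>
  Both kernels are powers \<open>p ^ (n - 1)\<close> of a ratio \<open>p = a / d\<close>, where \<open>d\<close> is the squared distance
  from \<open>z\<close> to the boundary point \<open>\<zeta>\<close> (respectively \<open>(y, 0)\<close>).  A direct computation gives
  \<open>|grad p| = 2 / d\<close> for the ball and \<open>|grad p| = 1 / d\<close> for the half-space, so the norm of the
  gradient of the kernel decreases with \<open>d\<close> and is largest at the boundary point nearest to \<open>z\<close>.
  Differentiating under the integral bounds \<open>|grad u|\<close> by this maximum times the L1 norm of the
  boundary function, and concentrating the boundary function near the maximizer shows sharpness.
\<close>

section \<open>Differentiation under the integral and sharp gradient bounds for abstract
  kernels\<close>

lemma integrable_bounded_kernel_mult:
  fixes g :: "'b \<Rightarrow> 'c::euclidean_space"
  assumes "integrable M (\<phi> :: 'b \<Rightarrow> real)" "g \<in> borel_measurable M"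
    and "\<And>y. y \<in> space M \<Longrightarrow> norm (g y) \<le> c"
  shows "integrable M (\<lambda>y. \<phi> y *\<^sub>R g y)"
proof (rule Bochner_Integration.integrable_bound[where f = "\<lambda>y. c * \<bar>\<phi> y\<bar>"])
  show "integrable M (\<lambda>y. c * \<bar>\<phi> y\<bar>)" using assms by auto
  show "(\<lambda>y. \<phi> y *\<^sub>R g y) \<in> borel_measurable M"
    using assms by measurable
  show "AE y in M. norm (\<phi> y *\<^sub>R g y) \<le> norm (c * \<bar>\<phi> y\<bar>)"
  proof (rule AE_I2)
    fix y assume "y \<in> space M"
    then have "norm (g y) \<le> \<bar>c\<bar>" using assms(3)[of y] by linarith
    then show "norm (\<phi> y *\<^sub>R g y) \<le> norm (c * \<bar>\<phi> y\<bar>)"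
      using mult_right_mono[of "norm (g y)" "\<bar>c\<bar>" "\<bar>\<phi> y\<bar>"]
      by (simp add: abs_mult mult.commute)
  qed
qed

text \<open>One setting for both integral operators: \<open>M\<close> lives on the boundary,
  \<open>S\<close> is the domain, and \<open>G\<close> is the gradient of the kernel
  \<open>K\<close> in its first argument. The bound \<open>B z\<close> is uniform in the boundary
  point, and its continuity makes it locally uniform in \<open>z\<close>, which supplies the
  domination. The metric on the boundary serves the sharpness argument, where test functions
  concentrate near a point.\<close>

locale differentiable_kernel =
  fixes M :: "'b::metric_space measure"
    and S :: "'a::euclidean_space set"
    and K :: "'a \<Rightarrow> 'b \<Rightarrow> real"
    and G :: "'a \<Rightarrow> 'b \<Rightarrow> 'a"
    and B :: "'a \<Rightarrow> real"
  assumes open_S: "open S"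
    and K_deriv: "z \<in> S \<Longrightarrow> y \<in> space M \<Longrightarrow> GDERIV (\<lambda>z. K z y) z :> G z y"
    and K_measurable: "z \<in> S \<Longrightarrow> K z \<in> borel_measurable M"
    and G_measurable: "z \<in> S \<Longrightarrow> G z \<in> borel_measurable M"
    and K_bounded: "z \<in> S \<Longrightarrow> \<exists>c. \<forall>y\<in>space M. \<bar>K z y\<bar> \<le> c"
    and G_le: "z \<in> S \<Longrightarrow> y \<in> space M \<Longrightarrow> norm (G z y) \<le> B z"
    and B_cont: "z \<in> S \<Longrightarrow> isCont B z"
begin

lemma integrable_K:
  assumes "integrable M \<phi>" "z \<in> S"
  shows "integrable M (\<lambda>y. K z y * \<phi> y)"
proof -
  obtain c where "\<And>y. y \<in> space M \<Longrightarrow> norm (K z y) \<le> c"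
    using K_bounded[OF assms(2)] by auto
  from integrable_bounded_kernel_mult[OF assms(1) K_measurable[OF assms(2)] this]
  show ?thesis by (simp add: mult.commute)
qed

lemma integrable_G:
  assumes "integrable M \<phi>" "z \<in> S"
  shows "integrable M (\<lambda>y. \<phi> y *\<^sub>R G z y)"
  using integrable_bounded_kernel_mult[OF assms(1) G_measurable[OF assms(2)] G_le[OF assms(2)]] .

text \<open>By continuity \<open>B\<close> stays below \<open>B x + 1\<close> on a small ball around
  \<open>x\<close>. The ball is convex, so the mean value inequality turns this gradient bound into
  one Lipschitz constant valid for all boundary points at once.\<close>

lemma locally_Lipschitz:
  assumes "x \<in> S"
  obtains r L where "r > 0" "ball x r \<subseteq> S" "L \<ge> 0"
    "\<And>z y. z \<in> ball x r \<Longrightarrow> y \<in> space M \<Longrightarrow> \<bar>K z y - K x y\<bar> \<le> L * norm (z - x)"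
proof -
  have "eventually (\<lambda>z. B z < B x + 1) (nhds x)"
    using B_cont[OF assms] unfolding isCont_def tendsto_at_iff_tendsto_nhds
    by (rule order_tendstoD) simp
  then have "eventually (\<lambda>z. z \<in> S \<and> B z < B x + 1) (nhds x)"
    using eventually_nhds_in_open[OF open_S assms] by eventually_elim auto
  then obtain r where r: "r > 0" "\<And>z. dist z x < r \<Longrightarrow> z \<in> S \<and> B z < B x + 1"
    unfolding eventually_nhds_metric by blast
  show thesis
  \<comment> \<open>The absolute value makes the constant nonnegative even if \<open>space M\<close>
    is empty, when the sign of \<open>B x\<close> is unconstrained.\<close>
  proof (rule that[of r "\<bar>B x + 1\<bar>"])
    show "ball x r \<subseteq> S" using r(2) by (auto simp: dist_commute)
    fix z y assume z: "z \<in> ball x r" and y: "y \<in> space M"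
    have "norm (K z y - K x y) \<le> \<bar>B x + 1\<bar> * norm (z - x)"
    proof (rule differentiable_bound[where S = "ball x r" and f = "\<lambda>z. K z y"
            and f' = "\<lambda>z (h::'a). h \<bullet> G z y"])
      fix w :: 'a assume "w \<in> ball x r"
      then have w: "w \<in> S" "B w < B x + 1" using r(2)[of w] by (auto simp: dist_commute)
      show "((\<lambda>z. K z y) has_derivative (\<lambda>h. h \<bullet> G w y)) (at w within ball x r)"
        using K_deriv[OF w(1) y] unfolding gderiv_def by (rule has_derivative_at_withinI)
      show "onorm (\<lambda>h. h \<bullet> G w y) \<le> \<bar>B x + 1\<bar>"
      proof (rule onorm_le)
        fix h :: 'a
        have "norm (G w y) \<le> \<bar>B x + 1\<bar>" using G_le[OF w(1) y] w(2) by linarith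
        then have "norm h * norm (G w y) \<le> norm h * \<bar>B x + 1\<bar>"
          by (rule mult_left_mono) simp
        then show "norm (h \<bullet> G w y) \<le> \<bar>B x + 1\<bar> * norm h"
          using Cauchy_Schwarz_ineq2[of h "G w y"] by (simp add: mult.commute)
      qed
    qed (use z r in auto)
    then show "\<bar>K z y - K x y\<bar> \<le> \<bar>B x + 1\<bar> * norm (z - x)" by simp
  qed (use r in auto)
qed

text \<open>Difference quotients converge pointwise and are dominated thanks to the local Lipschitz bound.\<close>
lemma GDERIV_integral:
  assumes \<phi>: "integrable M \<phi>" and x: "x \<in> S"
  shows "GDERIV (\<lambda>z. LINT y|M. K z y * \<phi> y) x :> (LINT y|M. \<phi> y *\<^sub>R G x y)"
proof -
  let ?u = "\<lambda>z. LINT y|M. K z y * \<phi> y"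
  let ?D = "LINT y|M. \<phi> y *\<^sub>R G x y"
  obtain r L where r: "r > 0" "ball x r \<subseteq> S" "L \<ge> 0"
    and Lip: "\<And>z y. z \<in> ball x r \<Longrightarrow> y \<in> space M \<Longrightarrow> \<bar>K z y - K x y\<bar> \<le> L * norm (z - x)"
    using locally_Lipschitz[OF x] by metis
  \<comment> \<open>The normalized remainder of the first-order expansion of the kernel at
    \<open>x\<close>. At \<open>z = x\<close> division by zero makes it 0.\<close>
  let ?q = "\<lambda>z y. (K z y - K x y - (z - x) \<bullet> G x y) / norm (z - x)"
  have q_lim: "((\<lambda>z. ?q z y) \<longlongrightarrow> 0) (at x)" if "y \<in> space M" for y
    using K_deriv[OF x that] unfolding gderiv_def has_derivative_iff_norm
    by (auto intro: tendsto_norm_zero_cancel)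
  have q_le: "\<bar>?q z y\<bar> \<le> L + \<bar>B x\<bar>" if "z \<in> ball x r" "y \<in> space M" for z y
  proof (cases "z = x")
    case False
    have "\<bar>(z - x) \<bullet> G x y\<bar> \<le> norm (z - x) * norm (G x y)" by (rule Cauchy_Schwarz_ineq2)
    also have "\<dots> \<le> norm (z - x) * \<bar>B x\<bar>"
      using G_le[OF x that(2)] by (intro mult_left_mono) auto
    finally have "\<bar>K z y - K x y - (z - x) \<bullet> G x y\<bar> \<le> (L + \<bar>B x\<bar>) * norm (z - x)"
      using Lip[OF that] by (simp add: algebra_simps)
    then show ?thesis using False by (simp add: divide_le_eq)
  qed (use r in simp)
  \<comment> \<open>By linearity, integrating the remainder of the kernel against
    \<open>\<phi>\<close> gives the remainder of \<open>?u\<close> with candidate gradient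
    \<open>?D\<close>. So it suffices that these integrals tend to 0.\<close>
  have q_int: "integrable M (\<lambda>y. \<phi> y * ?q z y)"
    and q_eq: "(LINT y|M. \<phi> y * ?q z y) = (?u z - ?u x - (z - x) \<bullet> ?D) / norm (z - x)"
    if "z \<in> ball x r" for z
  proof -
    have z: "z \<in> S" using that r by auto
    note int = integrable_K[OF \<phi> z] integrable_K[OF \<phi> x] integrable_G[OF \<phi> x]
    have int': "integrable M (\<lambda>y. (z - x) \<bullet> (\<phi> y *\<^sub>R G x y))"
      using int(3) by (rule integrable_inner_right)
    have eq: "(\<lambda>y. \<phi> y * ?q z y) = (\<lambda>y. (K z y * \<phi> y - K x y * \<phi> y
        - (z - x) \<bullet> (\<phi> y *\<^sub>R G x y)) / norm (z - x))"
      by (auto simp: fun_eq_iff algebra_simps add_divide_distrib diff_divide_distrib)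
    show "integrable M (\<lambda>y. \<phi> y * ?q z y)"
      unfolding eq using int int' by (intro integrable_divide Bochner_Integration.integrable_diff)
    show "(LINT y|M. \<phi> y * ?q z y) = (?u z - ?u x - (z - x) \<bullet> ?D) / norm (z - x)"
      unfolding eq using int int'
      by (simp add: Bochner_Integration.integral_diff Bochner_Integration.integrable_diff
          del: inner_scaleR_right)
  qed
  have "((\<lambda>z. LINT y|M. \<phi> y * ?q z y) \<longlongrightarrow> 0) (at x)"
    \<comment> \<open>Testing the limit along sequences that avoid \<open>x\<close> brings it into
      the form of dominated convergence.\<close>
    unfolding tendsto_at_iff_sequentially comp_def
  proof (intro allI impI)
    fix X :: "nat \<Rightarrow> 'a"
    assume X: "\<forall>i. X i \<in> UNIV - {x}" and Xx: "X \<longlonglongrightarrow> x"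
    have "eventually (\<lambda>i. X i \<in> ball x r) sequentially"
      using Xx r(1) by (intro topological_tendstoD) auto
    then obtain N where N: "\<And>i. i \<ge> N \<Longrightarrow> X i \<in> ball x r"
      unfolding eventually_sequentially by auto
    \<comment> \<open>The shift by \<open>N\<close> puts every term in \<open>ball x r\<close>,
      where the bound \<open>q_le\<close> holds.\<close>
    have "(\<lambda>i. LINT y|M. \<phi> y * ?q (X (i + N)) y) \<longlonglongrightarrow> (LINT y|M. 0)"
    proof (rule integral_dominated_convergence[where w = "\<lambda>y. (L + \<bar>B x\<bar>) * \<bar>\<phi> y\<bar>"])
      fix i
      have XN: "X (i + N) \<in> ball x r" using N by simp
      show "(\<lambda>y. \<phi> y * ?q (X (i + N)) y) \<in> borel_measurable M"
        using q_int[OF XN] by (rule borel_measurable_integrable)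
      show "AE y in M. norm (\<phi> y * ?q (X (i + N)) y) \<le> (L + \<bar>B x\<bar>) * \<bar>\<phi> y\<bar>"
      proof (rule AE_I2)
        fix y assume "y \<in> space M"
        then show "norm (\<phi> y * ?q (X (i + N)) y) \<le> (L + \<bar>B x\<bar>) * \<bar>\<phi> y\<bar>"
          using mult_right_mono[OF q_le[OF XN, of y], of "\<bar>\<phi> y\<bar>"]
          by (simp only: real_norm_def abs_mult abs_ge_zero mult.commute)
      qed
    next
      show "AE y in M. (\<lambda>i. \<phi> y * ?q (X (i + N)) y) \<longlonglongrightarrow> 0"
      proof (rule AE_I2)
        fix y assume "y \<in> space M"
        then have "(\<lambda>i. ?q (X i) y) \<longlonglongrightarrow> 0"
          using q_lim X Xx unfolding tendsto_at_iff_sequentially comp_def by blast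
        from tendsto_mult_right_zero[OF LIMSEQ_ignore_initial_segment[OF this, of N]]
        show "(\<lambda>i. \<phi> y * ?q (X (i + N)) y) \<longlonglongrightarrow> 0" .
      qed
    qed (use \<phi> in auto)
    then show "(\<lambda>i. LINT y|M. \<phi> y * ?q (X i) y) \<longlonglongrightarrow> 0"
      by (auto intro: LIMSEQ_offset[of _ N])
  qed
  then have "((\<lambda>z. (?u z - ?u x - (z - x) \<bullet> ?D) / norm (z - x)) \<longlongrightarrow> 0) (at x)"
  proof (rule Lim_transform_eventually)
    have "eventually (\<lambda>z. z \<in> ball x r) (at x)"
      using r(1) by (intro eventually_at_in_open') auto
    then show "eventually (\<lambda>z. (LINT y|M. \<phi> y * ?q z y)
        = (?u z - ?u x - (z - x) \<bullet> ?D) / norm (z - x)) (at x)"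
      by eventually_elim (rule q_eq)
  qed
  from tendsto_norm_zero[OF this] show ?thesis
    unfolding gderiv_def has_derivative_iff_norm
    by (auto intro: bounded_linear_inner_left)
qed

lemma gradient_integral:
  assumes "integrable M \<phi>" "x \<in> S"
  shows "gradient (\<lambda>z. LINT y|M. K z y * \<phi> y) x = (LINT y|M. \<phi> y *\<^sub>R G x y)"
  using GDERIV_integral[OF assms] by (rule gradient_eqI)

lemma norm_gradient_integral_le:
  assumes \<phi>: "integrable M \<phi>" and x: "x \<in> S"
  shows "norm (gradient (\<lambda>z. LINT y|M. K z y * \<phi> y) x) \<le> B x * L1_norm M \<phi>"
proof -
  have "norm (LINT y|M. \<phi> y *\<^sub>R G x y) \<le> (LINT y|M. norm (\<phi> y *\<^sub>R G x y))"
    by (rule integral_norm_bound)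
  also have "\<dots> \<le> (LINT y|M. B x * \<bar>\<phi> y\<bar>)"
  proof (rule integral_mono)
    fix y assume "y \<in> space M"
    then show "norm (\<phi> y *\<^sub>R G x y) \<le> B x * \<bar>\<phi> y\<bar>"
      using mult_right_mono[OF G_le[OF x], of y "\<bar>\<phi> y\<bar>"] by (simp add: mult.commute)
  qed (use \<phi> integrable_norm[OF integrable_G[OF \<phi> x]] in auto)
  finally show ?thesis
    by (simp add: gradient_integral[OF \<phi> x] L1_norm_def)
qed

text \<open>Test functions: indicators of balls shrinking to a maximizer of |G x|.\<close>
lemma gradient_bound_sharp:
  assumes x: "x \<in> S" and y0: "isCont (G x) y0" "norm (G x y0) = B x"
    and nbhd: "\<And>\<delta>. \<delta> > 0 \<Longrightarrow> ball y0 \<delta> \<inter> space M \<in> sets M \<and>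
      0 < emeasure M (ball y0 \<delta> \<inter> space M) \<and> emeasure M (ball y0 \<delta> \<inter> space M) < \<infinity>"
    and C: "\<And>\<phi>. integrable M \<phi> \<Longrightarrow>
      norm (gradient (\<lambda>z. LINT y|M. K z y * \<phi> y) x) \<le> C * L1_norm M \<phi>"
  shows "B x \<le> C"
proof (rule field_le_epsilon)
  fix e :: real assume "e > 0"
  then obtain \<delta> where \<delta>: "\<delta> > 0" "\<And>y. dist y y0 < \<delta> \<Longrightarrow> dist (G x y) (G x y0) < e"
    using y0(1) unfolding continuous_at_eps_delta by blast
  define A where "A = ball y0 \<delta> \<inter> space M"
  have A: "A \<in> sets M" "0 < emeasure M A" "emeasure M A < \<infinity>"
    using nbhd[OF \<delta>(1)] by (auto simp: A_def)
  have pos: "measure M A > 0"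
    using A by (simp add: measure_def enn2real_positive_iff)
  have int: "integrable M (indicator A :: 'b \<Rightarrow> real)"
    using A by (intro integrable_real_indicator)
  have L1: "L1_norm M (indicator A) = measure M A"
    using A by (simp add: L1_norm_def)
  \<comment> \<open>Pairing with the direction of the maximal gradient replaces the norm of a vector
    integral by a scalar integral. If \<open>G x y0\<close> vanishes, then \<open>v = 0\<close> and
    \<open>B x = 0\<close>, so both facts about \<open>v\<close> still hold.\<close>
  define v where "v = sgn (G x y0)"
  have v: "norm v \<le> 1" "G x y0 \<bullet> v = B x"
    by (cases "G x y0 = 0";
        simp add: v_def norm_sgn y0(2)[symmetric] sgn_div_norm dot_square_norm power2_eq_square)+
  have "(B x - e) * measure M A = (LINT y|M. (B x - e) * indicator A y)"
    using A by simp
  also have "\<dots> \<le> (LINT y|M. (indicator A y *\<^sub>R G x y) \<bullet> v)"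
  proof (rule integral_mono)
    fix y assume "y \<in> space M"
    \<comment> \<open>On \<open>A\<close> the kernel gradient differs from \<open>G x y0\<close> by
      less than \<open>e\<close>, so pairing with \<open>v\<close> loses at most
      \<open>e\<close>.\<close>
    have "B x - e \<le> G x y \<bullet> v" if "y \<in> A"
    proof -
      have "norm (G x y - G x y0) * norm v \<le> e * 1"
        using \<delta>(2)[of y] v(1) that \<open>e > 0\<close>
        by (intro mult_mono) (auto simp: A_def dist_norm dist_commute norm_minus_commute)
      then have "\<bar>(G x y - G x y0) \<bullet> v\<bar> \<le> e"
        using Cauchy_Schwarz_ineq2[of "G x y - G x y0" v] by linarith
      then show ?thesis using v(2) by (simp add: inner_diff_left)
    qed
    then show "(B x - e) * indicator A y \<le> (indicator A y *\<^sub>R G x y) \<bullet> v"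
      by (simp add: indicator_def)
  qed (use int integrable_G[OF int x] in \<open>auto intro: integrable_inner_left simp del: inner_scaleR_left\<close>)
  also have "\<dots> = gradient (\<lambda>z. LINT y|M. K z y * indicator A y) x \<bullet> v"
    unfolding gradient_integral[OF int x] using integrable_G[OF int x]
    by (rule integral_inner_left)
  also have "\<dots> \<le> norm (gradient (\<lambda>z. LINT y|M. K z y * indicator A y) x) * norm v"
    by (rule norm_cauchy_schwarz)
  also have "\<dots> \<le> norm (gradient (\<lambda>z. LINT y|M. K z y * indicator A y) x)"
    using v(1) by (simp add: mult_left_le)
  \<comment> \<open>The indicator of \<open>A\<close> has L1 norm \<open>measure M A\<close>, a
    positive number that cancels from both ends of the chain.\<close>
  also have "\<dots> \<le> C * measure M A"
    using C[OF int] by (simp add: L1)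
  finally show "B x \<le> C + e" using pos by simp
qed

text \<open>Bound and optimality in the shape needed for each half of the theorem. Differentiability
  is part of the conclusion because \<open>gradient\<close> is only meaningful where the derivative
  exists.\<close>

lemma sharp_gradient_estimate:
  assumes x: "x \<in> S" and y0: "isCont (G x) y0" "norm (G x y0) = B x"
    and nbhd: "\<And>\<delta>. \<delta> > 0 \<Longrightarrow> ball y0 \<delta> \<inter> space M \<in> sets M \<and>
      0 < emeasure M (ball y0 \<delta> \<inter> space M) \<and> emeasure M (ball y0 \<delta> \<inter> space M) < \<infinity>"
  shows "(\<forall>\<phi>. integrable M \<phi> \<longrightarrow>
           (\<lambda>z. LINT y|M. K z y * \<phi> y) differentiable (at x) \<and>
           norm (gradient (\<lambda>z. LINT y|M. K z y * \<phi> y) x) \<le> B x * L1_norm M \<phi>) \<and>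
         (\<forall>C. (\<forall>\<phi>. integrable M \<phi> \<longrightarrow>
           norm (gradient (\<lambda>z. LINT y|M. K z y * \<phi> y) x) \<le> C * L1_norm M \<phi>) \<longrightarrow> B x \<le> C)"
  using GDERIV_integral[OF _ x] norm_gradient_integral_le[OF _ x] gradient_bound_sharp[OF assms]
  unfolding gderiv_def differentiable_def by blast

end

lemma GDERIV_power:
  assumes "GDERIV f x :> D"
  shows "GDERIV (\<lambda>z. f z ^ k) x :> (real k * f x ^ (k - 1)) *\<^sub>R D"
  using assms unfolding gderiv_def
  by (auto intro!: derivative_eq_intros simp: algebra_simps)

section \<open>The Poisson-Szego kernel of the unit ball\<close>

definition ball_ratio :: "'a::euclidean_space \<Rightarrow> 'a \<Rightarrow> real" where
  "ball_ratio z \<zeta> = (1 - (norm z)\<^sup>2) / (norm (z - \<zeta>))\<^sup>2"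

text \<open>The quotient rule with the factor \<open>2 / d\<close> pulled out, \<open>d\<close>
  being the squared distance; the remaining vector is a unit vector when \<open>\<zeta>\<close> lies
  on the sphere.\<close>

definition ball_ratio_grad :: "'a::euclidean_space \<Rightarrow> 'a \<Rightarrow> 'a" where
  "ball_ratio_grad z \<zeta> = - ((2 / (norm (z - \<zeta>))\<^sup>2) *\<^sub>R (z + ball_ratio z \<zeta> *\<^sub>R (z - \<zeta>)))"

lemma GDERIV_ball_ratio:
  assumes "z \<noteq> \<zeta>"
  shows "GDERIV (\<lambda>z. ball_ratio z \<zeta>) z :> ball_ratio_grad z \<zeta>"
proof -
  have nz: "(z - \<zeta>) \<bullet> (z - \<zeta>) \<noteq> 0" using assms by simp
  \<comment> \<open>Squared norms are treated as inner products, which are smooth everywhere, so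
    \<open>z = 0\<close> is no special case.\<close>
  have dz: "((\<lambda>z. 1 - z \<bullet> z) has_derivative (\<lambda>h. - 2 * (h \<bullet> z))) (at z)"
    by (auto intro!: derivative_eq_intros simp: inner_commute)
  have dw: "((\<lambda>z. (z - \<zeta>) \<bullet> (z - \<zeta>)) has_derivative (\<lambda>h. 2 * (h \<bullet> (z - \<zeta>)))) (at z)"
    by (auto intro!: derivative_eq_intros simp: inner_commute)
  show ?thesis
    unfolding gderiv_def ball_ratio_def ball_ratio_grad_def power2_norm_eq_inner
    by (rule has_derivative_eq_rhs[OF has_derivative_divide[OF dz dw nz]])
      (use nz in \<open>simp add: fun_eq_iff inner_add_right divide_simps, simp add: algebra_simps\<close>)
qed

text \<open>With \<open>w = z - \<zeta>\<close>, the vector \<open>z + p *\<^sub>R w\<close> is the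
  reflection of \<open>\<zeta>\<close> in the hyperplane orthogonal to \<open>w\<close>, hence has
  norm 1. Algebraically, \<open>norm \<zeta> = 1\<close> expresses
  \<open>2 * (z \<bullet> w)\<close> through \<open>z \<bullet> z\<close> and \<open>d\<close>, and
  then \<open>p * d = 1 - z \<bullet> z\<close> collapses the square to 1.\<close>

lemma norm_ball_ratio_grad:
  assumes "norm \<zeta> = 1" "z \<noteq> \<zeta>"
  shows "norm (ball_ratio_grad z \<zeta>) = 2 / (norm (z - \<zeta>))\<^sup>2"
proof -
  define w where "w = z - \<zeta>"
  define d where "d = w \<bullet> w"
  define p where "p = ball_ratio z \<zeta>"
  have d: "d > 0" using assms by (simp add: d_def w_def)
  have "(z - w) \<bullet> (z - w) = 1" using assms by (simp add: w_def dot_square_norm)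
  then have e: "2 * (z \<bullet> w) = z \<bullet> z + d - 1"
    by (simp add: d_def algebra_simps inner_commute)
  have pd: "p * d = 1 - z \<bullet> z"
    using d by (simp add: p_def ball_ratio_def d_def w_def power2_norm_eq_inner)
  have "(norm (z + p *\<^sub>R w))\<^sup>2 = z \<bullet> z + p * (2 * (z \<bullet> w)) + p * (p * d)"
    unfolding power2_norm_eq_inner d_def by (simp add: algebra_simps inner_commute)
  also have "\<dots> = z \<bullet> z + p * d + p * (z \<bullet> z + p * d - 1)"
    unfolding e by (simp add: algebra_simps)
  also have "\<dots> = 1"
    unfolding pd by simp
  finally have "norm (z + p *\<^sub>R w) = 1"
    by (simp add: power2_eq_1_iff) (metis norm_ge_zero not_one_le_zero neg_0_le_iff_le)
  then show ?thesis
    by (simp add: ball_ratio_grad_def p_def w_def)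
qed

lemma dist_sphere_ge:
  assumes "norm \<zeta> = 1" "norm z < 1"
  shows "(1 - norm z)\<^sup>2 \<le> (norm (z - \<zeta>))\<^sup>2"
proof (rule power_mono)
  show "1 - norm z \<le> norm (z - \<zeta>)"
    using norm_triangle_ineq2[of \<zeta> z] assms(1) by (simp add: norm_minus_commute)
qed (use assms in simp)

text \<open>The distance from \<open>z\<close> to the sphere is at least \<open>1 - norm z\<close>,
  and one factor of \<open>1 - (norm z)\<^sup>2 = (1 + norm z) * (1 - norm z)\<close>
  cancels.\<close>

lemma ball_ratio_le:
  assumes "norm \<zeta> = 1" "norm z < 1"
  shows "ball_ratio z \<zeta> \<le> (1 + norm z) / (1 - norm z)"
proof -
  have s: "1 - (norm z)\<^sup>2 = (1 + norm z) * (1 - norm z)"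
    by (simp add: power2_eq_square algebra_simps)
  have "ball_ratio z \<zeta> \<le> (1 - (norm z)\<^sup>2) / (1 - norm z)\<^sup>2"
    unfolding ball_ratio_def using assms dist_sphere_ge[OF assms]
    by (intro divide_left_mono mult_pos_pos) (auto simp: s)
  also have "\<dots> = (1 + norm z) / (1 - norm z)"
    using assms unfolding s by (simp add: power2_eq_square)
  finally show ?thesis .
qed

lemma ball_ratio_nonneg: "norm z < 1 \<Longrightarrow> 0 \<le> ball_ratio z \<zeta>"
  by (simp add: ball_ratio_def power_le_one)

text \<open>The size of the kernel gradient at a boundary point nearest to \<open>z\<close>;
  \<open>k\<close> stands for \<open>n - 1\<close>. The factors are kept apart to match the bounds
  on the ratio and on its gradient.\<close>

definition ball_bound :: "nat \<Rightarrow> 'a::euclidean_space \<Rightarrow> real" where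
  "ball_bound k z = real k * ((1 + norm z) / (1 - norm z)) ^ (k - 1) * (2 / (1 - norm z)\<^sup>2)"

lemma ball_bound_eq:
  assumes "k \<ge> 1"
  shows "ball_bound k z = 2 * real k * (1 + norm z) ^ (k - 1) / (1 - norm z) ^ (k + 1)"
proof -
  obtain j where "k = Suc j" using assms by (cases k) auto
  then have "k - 1 = j" "k + 1 = j + 2" by simp_all
  then show ?thesis
    by (simp only: ball_bound_def power_divide power_add) simp
qed

text \<open>The power of the ratio and the factor \<open>2 / d\<close> are bounded separately.
  Nothing is lost, since both are largest at the same nearest boundary point.\<close>

lemma ball_kernel_grad_le:
  assumes "norm \<zeta> = 1" "norm z < 1"
  shows "norm ((real k * ball_ratio z \<zeta> ^ (k - 1)) *\<^sub>R ball_ratio_grad z \<zeta>) \<le> ball_bound k z"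
proof -
  have "z \<noteq> \<zeta>" using assms by auto
  have "real k * ball_ratio z \<zeta> ^ (k - 1) * (2 / (norm (z - \<zeta>))\<^sup>2) \<le> ball_bound k z"
    unfolding ball_bound_def
    using assms ball_ratio_le[OF assms] ball_ratio_nonneg[OF assms(2)] dist_sphere_ge[OF assms] \<open>z \<noteq> \<zeta>\<close>
    by (intro mult_mono mult_left_mono power_mono divide_left_mono mult_pos_pos) auto
  then show ?thesis
    using ball_ratio_nonneg[OF assms(2), of \<zeta>]
    by (simp add: norm_ball_ratio_grad[OF assms(1) \<open>z \<noteq> \<zeta>\<close>] abs_mult)
qed

text \<open>At the centre of the ball every boundary point is closest.\<close>
lemma ball_kernel_grad_maximizer:
  fixes z :: "'a::euclidean_space"
  assumes "norm z < 1"
  obtains \<zeta> where "norm \<zeta> = 1"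
    "norm ((real k * ball_ratio z \<zeta> ^ (k - 1)) *\<^sub>R ball_ratio_grad z \<zeta>) = ball_bound k z"
proof -
  obtain \<zeta> :: 'a where \<zeta>: "norm \<zeta> = 1" "z = norm z *\<^sub>R \<zeta>"
  proof (cases "z = 0")
    case True
    obtain b :: 'a where "b \<in> Basis" using nonempty_Basis by blast
    then show ?thesis using that[of b] True by simp
  next
    case False
    then show ?thesis using that[of "sgn z"] by (simp add: norm_sgn sgn_div_norm)
  qed
  \<comment> \<open>As \<open>z\<close> lies on the radius through \<open>\<zeta>\<close>, the
    distance between them is exactly \<open>1 - norm z\<close>.\<close>
  have "z - \<zeta> = (norm z - 1) *\<^sub>R \<zeta>" by (subst \<zeta>(2)) (simp add: algebra_simps)
  then have d: "norm (z - \<zeta>) = 1 - norm z" using assms \<zeta>(1) by simp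
  have s: "1 - (norm z)\<^sup>2 = (1 + norm z) * (1 - norm z)"
    by (simp add: power2_eq_square algebra_simps)
  have "ball_ratio z \<zeta> = (1 + norm z) / (1 - norm z)"
    unfolding ball_ratio_def d s using assms by (simp add: power2_eq_square)
  moreover have "z \<noteq> \<zeta>" using assms \<zeta>(1) by auto
  ultimately have "norm ((real k * ball_ratio z \<zeta> ^ (k - 1)) *\<^sub>R ball_ratio_grad z \<zeta>) = ball_bound k z"
    using ball_ratio_nonneg[OF assms, of \<zeta>]
    by (simp add: norm_ball_ratio_grad[OF \<zeta>(1)] abs_mult d ball_bound_def)
  with \<zeta>(1) show ?thesis by (rule that)
qed

section \<open>The ball kernel over the normalized surface measure\<close>

lemma borel_measurable_sphere_measure:
  assumes "f \<in> borel_measurable borel"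
  shows "f \<in> borel_measurable sphere_measure"
  unfolding sphere_measure_def using assms
  by (intro measurable_completion measurable_restrict_space1) simp

lemma differentiable_kernel_ball:
  "differentiable_kernel sphere_measure (ball (0::'a::euclidean_space) 1)
    (\<lambda>z \<zeta>. ball_ratio z \<zeta> ^ k) (\<lambda>z \<zeta>. (real k * ball_ratio z \<zeta> ^ (k - 1)) *\<^sub>R ball_ratio_grad z \<zeta>)
    (ball_bound k)"
proof
  fix z \<zeta> :: 'a
  assume "z \<in> ball 0 1" then have z: "norm z < 1" by simp
  show "(\<lambda>\<zeta>. ball_ratio z \<zeta> ^ k) \<in> borel_measurable sphere_measure"
    unfolding ball_ratio_def by (rule borel_measurable_sphere_measure) measurable
  show "(\<lambda>\<zeta>. (real k * ball_ratio z \<zeta> ^ (k - 1)) *\<^sub>R ball_ratio_grad z \<zeta>)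
      \<in> borel_measurable sphere_measure"
    unfolding ball_ratio_grad_def ball_ratio_def
    by (rule borel_measurable_sphere_measure) measurable
  show "\<exists>c. \<forall>y\<in>space sphere_measure. \<bar>ball_ratio z y ^ k\<bar> \<le> c"
    using ball_ratio_le[OF _ z] ball_ratio_nonneg[OF z]
    by (auto simp: space_sphere_measure abs_mult power_abs
        intro!: exI[of _ "((1 + norm z) / (1 - norm z)) ^ k"] power_mono)
  show "isCont (ball_bound k) z"
    unfolding ball_bound_def using z by (intro continuous_intros) auto
  assume "\<zeta> \<in> space sphere_measure"
  then have \<zeta>: "norm \<zeta> = 1" by (simp add: space_sphere_measure)
  then have "z \<noteq> \<zeta>" using z by auto
  then show "GDERIV (\<lambda>z. ball_ratio z \<zeta> ^ k) z :>
      (real k * ball_ratio z \<zeta> ^ (k - 1)) *\<^sub>R ball_ratio_grad z \<zeta>"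
    by (intro GDERIV_power GDERIV_ball_ratio)
  show "norm ((real k * ball_ratio z \<zeta> ^ (k - 1)) *\<^sub>R ball_ratio_grad z \<zeta>) \<le> ball_bound k z"
    using \<zeta> z by (rule ball_kernel_grad_le)
qed simp

text \<open>These are the neighborhoods on which test functions concentrate. Finiteness comes from
  the total mass 1. For positivity, the cone over a relatively open cap is a nonempty open set,
  which has positive volume.\<close>

lemma sphere_measure_ball:
  fixes \<zeta> :: "'a::euclidean_space"
  assumes "norm \<zeta> = 1" "\<delta> > 0"
  shows "ball \<zeta> \<delta> \<inter> space sphere_measure \<in> sets sphere_measure"
    and "0 < emeasure sphere_measure (ball \<zeta> \<delta> \<inter> space sphere_measure)"
    and "emeasure sphere_measure (ball \<zeta> \<delta> \<inter> space sphere_measure) < \<infinity>"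
proof -
  let ?A = "ball \<zeta> \<delta> \<inter> sphere (0::'a) 1"
  let ?D = "distr (uniform_measure lborel (ball (0::'a) 1)) borel sgn"
  have "?A \<in> sets (restrict_space ?D (sphere 0 1))"
    by (subst sets_restrict_space_iff) auto
  then show meas: "ball \<zeta> \<delta> \<inter> space sphere_measure \<in> sets sphere_measure"
    unfolding space_sphere_measure unfolding sphere_measure_def by (rule sets_completionI_sets)
  have "emeasure sphere_measure ?A \<le> emeasure sphere_measure (space (sphere_measure :: 'a measure))"
    by (rule emeasure_space)
  then show "emeasure sphere_measure (ball \<zeta> \<delta> \<inter> space sphere_measure) < \<infinity>"
    unfolding space_sphere_measure emeasure_sphere_measure_space
    by (rule order_le_less_trans) simp
  let ?U = "{x \<in> ball 0 1. sgn x \<in> ?A}"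
  \<comment> \<open>The origin drops out because \<open>sgn 0 = 0\<close> is not on the sphere; away
    from it \<open>sgn\<close> is continuous.\<close>
  have U: "?U = (ball 0 1 - {0}) \<inter> sgn -` ball \<zeta> \<delta>"
    by (auto simp: norm_sgn)
  have "continuous_on (ball 0 1 - {0::'a}) sgn"
    unfolding sgn_div_norm by (intro continuous_intros) auto
  then have "open ?U"
    unfolding U by (rule continuous_open_preimage) auto
  \<comment> \<open>The midpoint of the radius through \<open>\<zeta>\<close> is a point of the
    cone.\<close>
  moreover have "sgn ((1/2) *\<^sub>R \<zeta>) = \<zeta>"
    using assms by (simp add: sgn_div_norm)
  then have "(1/2) *\<^sub>R \<zeta> \<in> ?U" using assms by simp
  then have "?U \<noteq> {}" by blast
  ultimately have "?U \<notin> null_sets lborel" and "?U \<in> sets lborel"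
    using open_not_negligible[of ?U]
    by (auto simp: negligible_iff_null_sets null_sets_completionI)
  then have "emeasure lborel ?U > 0"
    by (simp add: null_sets_def zero_less_iff_neq_zero)
  \<comment> \<open>The denominator must be finite, as a quotient by infinity would be 0.\<close>
  moreover have "emeasure lborel (ball (0::'a) 1) < \<infinity>"
    using emeasure_lborel_ball_finite[of "0::'a" 1] by simp
  ultimately show "0 < emeasure sphere_measure (ball \<zeta> \<delta> \<inter> space sphere_measure)"
    unfolding space_sphere_measure
    by (subst emeasure_sphere_measure) (auto simp: ennreal_zero_less_divide)
qed

section \<open>The Poisson-Szego kernel of the half-space\<close>

definition half_ratio :: "'a::euclidean_space \<times> real \<Rightarrow> 'a \<Rightarrow> real" where
  "half_ratio z y = snd z / ((norm (fst z - y))\<^sup>2 + (snd z)\<^sup>2)"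

definition half_ratio_grad :: "'a::euclidean_space \<times> real \<Rightarrow> 'a \<Rightarrow> 'a \<times> real" where
  "half_ratio_grad z y = (1 / ((norm (fst z - y))\<^sup>2 + (snd z)\<^sup>2)) *\<^sub>R
     (- (2 * half_ratio z y) *\<^sub>R (fst z - y), 1 - 2 * half_ratio z y * snd z)"

lemma GDERIV_half_ratio:
  fixes z :: "'a::euclidean_space \<times> real"
  assumes "snd z > 0"
  shows "GDERIV (\<lambda>z. half_ratio z y) z :> half_ratio_grad z y"
proof -
  have nz: "(fst z - y) \<bullet> (fst z - y) + (snd z)\<^sup>2 \<noteq> 0"
    using assms by (simp add: add_nonneg_eq_0_iff)
  have dz: "((\<lambda>z :: 'a \<times> real. snd z) has_derivative (\<lambda>h. snd h)) (at z)"
    by (auto intro!: derivative_eq_intros)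
  have dw: "((\<lambda>z. (fst z - y) \<bullet> (fst z - y) + (snd z)\<^sup>2) has_derivative
      (\<lambda>h. 2 * (fst h \<bullet> (fst z - y)) + 2 * (snd h * snd z))) (at z)"
    by (auto intro!: derivative_eq_intros simp: inner_commute fun_eq_iff)
  show ?thesis
    unfolding gderiv_def half_ratio_def half_ratio_grad_def power2_norm_eq_inner
    by (rule has_derivative_eq_rhs[OF has_derivative_divide[OF dz dw nz]])
      (use nz in \<open>simp add: fun_eq_iff inner_prod_def divide_simps, simp add: algebra_simps\<close>)
qed

text \<open>After the factor \<open>1 / d\<close>, what remains is the reflection of the vertical
  unit vector \<open>(0, 1)\<close> in the hyperplane orthogonal to \<open>(w, t)\<close>, so its
  norm is 1. The computation rests on \<open>p * d = t\<close>.\<close>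

lemma norm_half_ratio_grad:
  fixes z :: "'a::euclidean_space \<times> real"
  assumes "snd z > 0"
  shows "norm (half_ratio_grad z y) = 1 / ((norm (fst z - y))\<^sup>2 + (snd z)\<^sup>2)"
proof -
  define t where "t = snd z"
  define w where "w = fst z - y"
  define d where "d = w \<bullet> w + t\<^sup>2"
  define p where "p = half_ratio z y"
  have d: "d > 0" using assms by (simp add: d_def t_def add_nonneg_pos)
  have pd: "p * d = t"
    using d by (simp add: p_def half_ratio_def d_def w_def t_def power2_norm_eq_inner)
  have "(norm (- (2 * p) *\<^sub>R w, 1 - 2 * p * t))\<^sup>2 = 1 + 4 * p * (p * d) - 4 * p * t"
    unfolding power2_norm_eq_inner d_def by (simp add: inner_prod_def algebra_simps power2_eq_square)
  also have "\<dots> = 1" unfolding pd by simp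
  finally have "norm (- (2 * p) *\<^sub>R w, 1 - 2 * p * t) = 1"
    by (simp add: power2_eq_1_iff) (metis norm_ge_zero not_one_le_zero neg_0_le_iff_le)
  then show ?thesis
    using d unfolding half_ratio_grad_def norm_scaleR d_def t_def w_def p_def
    by (simp add: power2_norm_eq_inner)
qed

lemma half_ratio_le:
  assumes "snd z > 0"
  shows "half_ratio z y \<le> 1 / snd z"
proof -
  have "half_ratio z y \<le> snd z / (snd z)\<^sup>2"
    unfolding half_ratio_def using assms by (intro divide_left_mono mult_pos_pos) (auto simp: add_nonneg_pos)
  then show ?thesis using assms by (simp add: power2_eq_square)
qed

lemma half_ratio_nonneg: "snd z > 0 \<Longrightarrow> 0 \<le> half_ratio z y"
  by (simp add: half_ratio_def)

text \<open>The constant \<open>c\<close> is carried inside the kernel so that the normalized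
  integral is itself an instance of the abstract setting. The bound is the value at
  \<open>y = fst z\<close>, where the squared distance is smallest.\<close>

lemma differentiable_kernel_half:
  assumes "c \<ge> 0"
  shows "differentiable_kernel lebesgue (upper_halfspace :: ((real^'m) \<times> real) set)
    (\<lambda>z y. c * half_ratio z y ^ k)
    (\<lambda>z y. (c * (real k * half_ratio z y ^ (k - 1))) *\<^sub>R half_ratio_grad z y)
    (\<lambda>z. c * (real k * (1 / snd z) ^ (k - 1) * (1 / (snd z)\<^sup>2)))"
proof
  show "open (upper_halfspace :: ((real^'m) \<times> real) set)"
    unfolding upper_halfspace_def by (intro open_Collect_less continuous_intros)
next
  fix z :: "(real^'m) \<times> real" and y :: "real^'m"
  assume "z \<in> upper_halfspace" then have z: "snd z > 0" by (simp add: upper_halfspace_def)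
  show "(\<lambda>y. c * half_ratio z y ^ k) \<in> borel_measurable lebesgue"
    unfolding half_ratio_def by (rule measurable_completion) simp
  show "(\<lambda>y. (c * (real k * half_ratio z y ^ (k - 1))) *\<^sub>R half_ratio_grad z y)
      \<in> borel_measurable lebesgue"
    unfolding half_ratio_grad_def half_ratio_def
    by (rule measurable_completion) (simp add: borel_measurable_Pair)
  show "\<exists>b. \<forall>y\<in>space lebesgue. \<bar>c * half_ratio z y ^ k\<bar> \<le> b"
    using half_ratio_le[OF z] half_ratio_nonneg[OF z] assms
    by (auto simp: abs_mult power_abs simp del: power_one_over
        intro!: exI[of _ "c * (1 / snd z) ^ k"] power_mono mult_left_mono)
  show "isCont (\<lambda>z. c * (real k * (1 / snd z) ^ (k - 1) * (1 / (snd z)\<^sup>2))) z"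
    using z by (intro continuous_intros) auto
  show "GDERIV (\<lambda>z. c * half_ratio z y ^ k) z :>
      (c * (real k * half_ratio z y ^ (k - 1))) *\<^sub>R half_ratio_grad z y"
    using GDERIV_mult[OF GDERIV_const GDERIV_power[OF GDERIV_half_ratio[OF z]]]
    by simp
  have "real k * half_ratio z y ^ (k - 1) * (1 / ((norm (fst z - y))\<^sup>2 + (snd z)\<^sup>2))
      \<le> real k * (1 / snd z) ^ (k - 1) * (1 / (snd z)\<^sup>2)"
    using z half_ratio_le[OF z] half_ratio_nonneg[OF z]
    by (intro mult_mono mult_left_mono power_mono divide_left_mono mult_pos_pos)
      (auto simp: add_nonneg_pos)
  from mult_left_mono[OF this assms]
  show "norm ((c * (real k * half_ratio z y ^ (k - 1))) *\<^sub>R half_ratio_grad z y)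
      \<le> c * (real k * (1 / snd z) ^ (k - 1) * (1 / (snd z)\<^sup>2))"
    using half_ratio_nonneg[OF z, of y] assms
    by (simp add: norm_half_ratio_grad[OF z] abs_mult)
qed

section \<open>The sharp estimates on the ball and on the half-space\<close>

theorem theorem1p7:
  fixes n :: nat
  assumes "n \<ge> 3"
    and "CARD('n::finite) = n"
    and "CARD('m::finite) = n - 1"
  shows
    "(\<forall>x \<in> ball (0 :: real^'n) 1.
        (\<forall>\<phi>. integrable sphere_measure \<phi> \<longrightarrow>
           poisson_ball \<phi> differentiable (at x) \<and>
           norm (gradient (poisson_ball \<phi>) x)
             \<le> 2 * (real n - 1) * (1 + norm x) ^ (n - 2) / (1 - norm x) ^ n
                * L1_norm sphere_measure \<phi>) \<and>
        (\<forall>C. (\<forall>\<phi>. integrable sphere_measure \<phi> \<longrightarrow>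
                norm (gradient (poisson_ball \<phi>) x) \<le> C * L1_norm sphere_measure \<phi>) \<longrightarrow>
             2 * (real n - 1) * (1 + norm x) ^ (n - 2) / (1 - norm x) ^ n \<le> C))
     \<and>
     (\<forall>x \<in> (upper_halfspace :: ((real^'m) \<times> real) set).
        (\<forall>\<phi>. integrable lebesgue \<phi> \<longrightarrow>
           poisson_halfspace \<phi> differentiable (at x) \<and>
           norm (gradient (poisson_halfspace \<phi>) x)
             \<le> 2 ^ (n - 2) * (real n - 1) * Gamma (real n / 2)
                  / (pi powr (real n / 2) * snd x ^ n)
                * L1_norm lebesgue \<phi>) \<and>
        (\<forall>C. (\<forall>\<phi>. integrable lebesgue \<phi> \<longrightarrow>
                norm (gradient (poisson_halfspace \<phi>) x) \<le> C * L1_norm lebesgue \<phi>) \<longrightarrow>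
             2 ^ (n - 2) * (real n - 1) * Gamma (real n / 2)
               / (pi powr (real n / 2) * snd x ^ n) \<le> C))"
proof (intro conjI ballI)
  fix x :: "real^'n" assume x: "x \<in> ball 0 1"
  then have nx: "norm x < 1" by simp
  interpret differentiable_kernel sphere_measure "ball (0 :: real^'n) 1"
    "\<lambda>z \<zeta>. ball_ratio z \<zeta> ^ (n - 1)"
    "\<lambda>z \<zeta>. (real (n - 1) * ball_ratio z \<zeta> ^ (n - 1 - 1)) *\<^sub>R ball_ratio_grad z \<zeta>"
    "ball_bound (n - 1)"
    by (rule differentiable_kernel_ball)
  obtain \<zeta> :: "real^'n" where \<zeta>: "norm \<zeta> = 1"
    "norm ((real (n - 1) * ball_ratio x \<zeta> ^ (n - 1 - 1)) *\<^sub>R ball_ratio_grad x \<zeta>)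
      = ball_bound (n - 1) x"
    using ball_kernel_grad_maximizer[OF nx] by blast
  have "x \<noteq> \<zeta>" using nx \<zeta>(1) by auto
  then have cont: "isCont (\<lambda>\<zeta>. (real (n - 1) * ball_ratio x \<zeta> ^ (n - 1 - 1))
      *\<^sub>R ball_ratio_grad x \<zeta>) \<zeta>"
    unfolding ball_ratio_grad_def ball_ratio_def by (intro continuous_intros) auto
  have eq: "poisson_ball \<phi> = (\<lambda>z. LINT \<zeta>|sphere_measure. ball_ratio z \<zeta> ^ (n - 1) * \<phi> \<zeta>)"
    for \<phi> :: "real^'n \<Rightarrow> real"
    by (simp add: fun_eq_iff poisson_ball_def ball_ratio_def assms(2))
  \<comment> \<open>For \<open>k = n - 1\<close> the exponents \<open>k - 1\<close> and
    \<open>k + 1\<close> become \<open>n - 2\<close> and \<open>n\<close>.\<close>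
  have B: "2 * (real n - 1) * (1 + norm x) ^ (n - 2) / (1 - norm x) ^ n = ball_bound (n - 1) x"
    using assms(1) by (subst ball_bound_eq) (auto simp: of_nat_diff numeral_2_eq_2)
  note est = sharp_gradient_estimate[OF x cont \<zeta>(2)]
  show "\<forall>\<phi>. integrable sphere_measure \<phi> \<longrightarrow>
      poisson_ball \<phi> differentiable (at x) \<and>
      norm (gradient (poisson_ball \<phi>) x)
        \<le> 2 * (real n - 1) * (1 + norm x) ^ (n - 2) / (1 - norm x) ^ n
           * L1_norm sphere_measure \<phi>"
    unfolding eq B using est sphere_measure_ball[OF \<zeta>(1)] by blast
  show "\<forall>C. (\<forall>\<phi>. integrable sphere_measure \<phi> \<longrightarrow>
        norm (gradient (poisson_ball \<phi>) x) \<le> C * L1_norm sphere_measure \<phi>) \<longrightarrow>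
      2 * (real n - 1) * (1 + norm x) ^ (n - 2) / (1 - norm x) ^ n \<le> C"
    unfolding eq B using est sphere_measure_ball[OF \<zeta>(1)] by blast
next
  fix x :: "(real^'m) \<times> real" assume x: "x \<in> upper_halfspace"
  then have sx: "snd x > 0" by (simp add: upper_halfspace_def)
  \<comment> \<open>The integral is normalized with \<open>CARD('m) + 1\<close>, which equals
    \<open>n\<close>.\<close>
  define c where "c = halfspace_const n"
  have c: "c \<ge> 0"
    using assms(1) by (simp add: c_def halfspace_const_def Gamma_real_nonneg)
  interpret differentiable_kernel lebesgue "upper_halfspace :: ((real^'m) \<times> real) set"
    "\<lambda>z y. c * half_ratio z y ^ (n - 1)"
    "\<lambda>z y. (c * (real (n - 1) * half_ratio z y ^ (n - 1 - 1))) *\<^sub>R half_ratio_grad z y"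
    "\<lambda>z. c * (real (n - 1) * (1 / snd z) ^ (n - 1 - 1) * (1 / (snd z)\<^sup>2))"
    by (rule differentiable_kernel_half[OF c])
  have "(norm (fst x - y))\<^sup>2 + (snd x)\<^sup>2 \<noteq> 0" for y
    using sx by (simp add: add_nonneg_eq_0_iff)
  then have cont: "isCont (\<lambda>y. (c * (real (n - 1) * half_ratio x y ^ (n - 1 - 1)))
      *\<^sub>R half_ratio_grad x y) (fst x)"
    unfolding half_ratio_grad_def half_ratio_def by (intro continuous_intros) auto
  \<comment> \<open>The nearest boundary point is the foot \<open>fst x\<close>, at distance
    \<open>snd x\<close>, so every estimate in the bound becomes an equality there.\<close>
  have max: "norm ((c * (real (n - 1) * half_ratio x (fst x) ^ (n - 1 - 1)))
      *\<^sub>R half_ratio_grad x (fst x))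
      = c * (real (n - 1) * (1 / snd x) ^ (n - 1 - 1) * (1 / (snd x)\<^sup>2))"
  proof -
    have "half_ratio x (fst x) = 1 / snd x"
      using sx by (simp add: half_ratio_def power2_eq_square)
    then show ?thesis
      using sx c by (simp add: norm_half_ratio_grad[OF sx] abs_mult)
  qed
  have nbhd: "ball (fst x) \<delta> \<inter> space lebesgue \<in> sets lebesgue \<and>
      0 < emeasure lebesgue (ball (fst x) \<delta> \<inter> space lebesgue) \<and>
      emeasure lebesgue (ball (fst x) \<delta> \<inter> space lebesgue) < \<infinity>" if "\<delta> > 0" for \<delta>
    using that emeasure_lborel_ball_finite[of "fst x" \<delta>] open_not_negligible[of "ball (fst x) \<delta>"]
    by (auto simp: negligible_iff_null_sets null_sets_def zero_less_iff_neq_zero)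
  have eq: "poisson_halfspace \<phi> = (\<lambda>z. LINT y|lebesgue. c * half_ratio z y ^ (n - 1) * \<phi> y)"
    for \<phi> :: "real^'m \<Rightarrow> real"
    using assms by (simp add: fun_eq_iff poisson_halfspace_def half_ratio_def c_def mult.assoc)
  have B: "2 ^ (n - 2) * (real n - 1) * Gamma (real n / 2) / (pi powr (real n / 2) * snd x ^ n)
      = c * (real (n - 1) * (1 / snd x) ^ (n - 1 - 1) * (1 / (snd x)\<^sup>2))"
  proof -
    \<comment> \<open>Writing \<open>n = j + 2\<close> resolves the truncated subtractions: the
      exponents \<open>j\<close> and 2 of \<open>1 / snd x\<close> add up to
      \<open>n\<close>.\<close>
    obtain j where n: "n = j + 2"
      using le_Suc_ex[of 2 n] assms(1) by (auto simp: add.commute)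
    have *: "n - 1 - 1 = j" "n - 2 = j" "real n - 1 = real (n - 1)"
      "snd x ^ n = snd x ^ j * (snd x)\<^sup>2"
      by (simp_all add: n power_add power2_eq_square)
    show ?thesis
      unfolding c_def halfspace_const_def * power_one_over by simp
  qed
  note est = sharp_gradient_estimate[OF x cont max nbhd]
  show "\<forall>\<phi>. integrable lebesgue \<phi> \<longrightarrow>
      poisson_halfspace \<phi> differentiable (at x) \<and>
      norm (gradient (poisson_halfspace \<phi>) x)
        \<le> 2 ^ (n - 2) * (real n - 1) * Gamma (real n / 2)
             / (pi powr (real n / 2) * snd x ^ n)
           * L1_norm lebesgue \<phi>"
    unfolding eq B using est by blast
  show "\<forall>C. (\<forall>\<phi>. integrable lebesgue \<phi> \<longrightarrow>
        norm (gradient (poisson_halfspace \<phi>) x) \<le> C * L1_norm lebesgue \<phi>) \<longrightarrow>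
      2 ^ (n - 2) * (real n - 1) * Gamma (real n / 2)
        / (pi powr (real n / 2) * snd x ^ n) \<le> C"
    unfolding eq B using est by blast
qed

end
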